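(* Consider the problems (P), (D), (MP), (MD) and the linear map $M$ described in the context, where $s^j\in K_j$ if and only if $M^js^j\in\mathcal{K}_j$ for all $s^j\in\mathbb{R}^{q_j}$, $j\in J$, and assume that strong duality holds for (P)-(D). Assume that $M^\top\mathcal{K}^+$ is closed, that $M$ is one to one, and that for every $j\in J$ and all $s^j\in K_j$, $M^js^j\in\partial\mathcal{K}_j$ if and only if $s^j\in\partial K_j$. Then $$B_{P}=B_{MP},\qquad N_{P}=N_{MP},\qquad N^0_{P}=N^0_{MP},\qquad B^0_{P}\supseteq B^0_{MP}.$$ Additionally, suppose that $z=0$ is the only element $z\in\mathcal{K}^+$ such that $M^\top z=0$. Then $B^0_{P}=B^0_{MP}$; in particular, the six-partitions of (P) and (MP) coincide.
   Context: Let $J=\{1,\dots,r\}$. For each $j\in J$ let $K_j\subset\mathbb{R}^{q_j}$ and $\mathcal{K}_j\subset\mathbb{R}^{r_j}$ be closed convex regular cones (regular: nonempty interior and pointed), $A^j\in\mathbb{R}^{q_j\times n}$, $b^j\in\mathbb{R}^{q_j}$, $M^j\in\mathbb{R}^{r_j\times q_j}$, and let $c\in\mathbb{R}^n$. It is assumed throughout that for all $j\in J$ and $s^j\in\mathbb{R}^{q_j}$: $s^j\in K_j$ iff $M^js^j\in\mathcal{K}_j$. Put $\mathcal{K}=\prod_j\mathcal{K}_j$ and let $M$ be the linear map $M(s^1,\dots,s^r)=(M^1s^1,\dots,M^rs^r)$, so $M^\top(z^1,\dots,z^r)=((M^1)^\top z^1,\dots,(M^r)^\top z^r)$. For a set $Q$,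 $Q^+=\{y: y^\top z\ge0\ \forall z\in Q\}$; $\partial$ denotes boundary and $\operatorname{int}$ interior. The problems are $$(P)\ \min_x c^\top x\ \text{ s.t. } A^jx-b^j\in K_j\ \forall j\in J;\qquad (D)\ \max_y \sum_j (b^j)^\top y^j\ \text{ s.t. } \sum_j(A^j)^\top y^j=c,\ y^j\in K_j^+\ \forall j\in J;$$ $$(MP)\ \min_x c^\top x\ \text{ s.t. } M^j(A^jx-b^j)\in\mathcal{K}_j\ \forall j\in J;\qquad (MD)\ \max_z \sum_j (b^j)^\top (M^j)^\top z^j\ \text{ s.t. } \sum_j(A^j)^\top(M^j)^\top z^j=c,\ z^j\in\mathcal{K}_j^+\ \forall j\in J.$$ Strong duality for (P)-(D) means that both optimal solution sets are nonempty and the duality gap is zero. Let $S(C)$ be the set of $(x,y)$ with $A^jx-b^j\in K_j$, $y^j\in K_j^+$, $(y^j)^\top(A^jx-b^j)=0$ for all $j$, and $\sum_j(A^j)^\top y^j=c$. Define $B_P=\{j:\exists(x,y)\in S(C),\ A^jx-b^j\in\operatorname{int}K_j\}$, $N_P=\{j:\exists(x,y)\in S(C),\ y^j\in\operatorname{int}K_j^+\}$, $B^0_P=\{j: y^j=0\ \forall(x,y)\in S(C)\}$, $N^0_P=\{j: A^jx-b^j=0\ \forall(x,y)\in S(C)\}$. The six-partition of (P) consists of $B_P$, $N_P$, $B'_P=B^0_P\setminus(N^0_P\cup B_P)$, $N'_P=N^0_P\setminus(B^0_P\cup N_P)$, $O_P=B^0_P\cap N^0_P$, $C_P=J\setminus(B^0_P\cup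 N^0_P)$. The sets $B_{MP},N_{MP},B^0_{MP},N^0_{MP}$ and the six-partition of (MP) are defined in the same way with $A^jx-b^j$, $K_j$, $y^j$ replaced by $M^j(A^jx-b^j)$, $\mathcal{K}_j$, $z^j$, and $S(C)$ replaced by the set of $(x,z)$ with $M^j(A^jx-b^j)\in\mathcal{K}_j$, $z^j\in\mathcal{K}_j^+$, $(z^j)^\top M^j(A^jx-b^j)=0$ for all $j$, and $\sum_j(A^j)^\top(M^j)^\top z^j=c$. *)

theory Defs
  imports "HOL-Analysis.Analysis" "Jordan_Normal_Form.Matrix"
begin

unbundle no vec_syntax and no inner_syntax

text \<open>
  The block dimensions vary with the index of the block, so a point of \<open>\<real>\<^sup>n\<close> is an element of
  \<^term>\<open>carrier_vec n :: real vec set\<close>.  Vectors carry no topology in the library; the usual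
  topology of \<open>\<real>\<^sup>n\<close> is transported from \<^const>\<open>Euclidean_space\<close>.
\<close>

definition vec_topology :: "nat \<Rightarrow> real vec topology" where
  "vec_topology n =
     pullback_topology (carrier_vec n) (\<lambda>v i. if i < n then v $ i else 0) (Euclidean_space n)"

lemma topspace_vec_topology [simp]: "topspace (vec_topology n) = carrier_vec n"
  by (auto simp: vec_topology_def topspace_pullback_topology topspace_Euclidean_space)

definition regular_cone :: "nat \<Rightarrow> real vec set \<Rightarrow> bool" where
  "regular_cone n K \<longleftrightarrow>
     K \<subseteq> carrier_vec n \<and>
     closedin (vec_topology n) K \<and>
     (\<forall>u\<in>K. \<forall>t\<ge>0. t \<cdot>\<^sub>v u \<in> K) \<and>
     (\<forall>u\<in>K. \<forall>v\<in>K. \<forall>t\<in>{0..1}. (1 - t) \<cdot>\<^sub>v u + t \<cdot>\<^sub>v v \<in> K) \<and>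
     (vec_topology n) interior_of K \<noteq> {} \<and>
     (\<forall>u\<in>K. - u \<in> K \<longrightarrow> u = 0\<^sub>v n)"

definition dual_cone :: "nat \<Rightarrow> real vec set \<Rightarrow> real vec set" where
  "dual_cone n Q = {y \<in> carrier_vec n. \<forall>z\<in>Q. y \<bullet> z \<ge> 0}"

text \<open>
  Block vectors \<open>(s\<^sup>j)\<^sub>j\<^sub>\<in>\<^sub>J\<close> are the extensional functions in
  \<open>\<Pi>\<^sub>E j\<in>J. carrier_vec (d j)\<close>.
\<close>

definition dual_cone_prod ::
  "nat set \<Rightarrow> (nat \<Rightarrow> nat) \<Rightarrow> (nat \<Rightarrow> real vec) set \<Rightarrow> (nat \<Rightarrow> real vec) set" where
  "dual_cone_prod J d Q =
     {y \<in> (\<Pi>\<^sub>E j\<in>J. carrier_vec (d j)). \<forall>z\<in>Q. (\<Sum>j\<in>J. y j \<bullet> z j) \<ge> 0}"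

definition block_map ::
  "nat set \<Rightarrow> (nat \<Rightarrow> real mat) \<Rightarrow> (nat \<Rightarrow> real vec) \<Rightarrow> (nat \<Rightarrow> real vec)" where
  "block_map J M s = (\<lambda>j\<in>J. M j *\<^sub>v s j)"

text \<open>
  A pair of dual multi-cone problems: minimise \<open>c\<^sup>T x\<close> over \<open>x \<in> \<real>\<^sup>n\<close> with
  \<open>slack j x \<in> cone j\<close> for all \<open>j\<close>, and maximise \<open>dual_obj y\<close> over the \<open>y\<close> with
  \<open>(\<Sum>j. adj j (y j)) = c\<close> and \<open>y j\<close> in the dual of \<open>cone j\<close> for all \<open>j\<close>.
\<close>

record problem =
  nvars :: nat
  idx :: "nat set"
  bdim :: "nat \<Rightarrow> nat"
  cone :: "nat \<Rightarrow> real vec set"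
  slack :: "nat \<Rightarrow> real vec \<Rightarrow> real vec"
  adj :: "nat \<Rightarrow> real vec \<Rightarrow> real vec"
  cost :: "real vec"
  dual_obj :: "(nat \<Rightarrow> real vec) \<Rightarrow> real"

definition problem_P ::
  "nat \<Rightarrow> nat set \<Rightarrow> (nat \<Rightarrow> nat) \<Rightarrow> (nat \<Rightarrow> real vec set) \<Rightarrow>
   (nat \<Rightarrow> real mat) \<Rightarrow> (nat \<Rightarrow> real vec) \<Rightarrow> real vec \<Rightarrow> problem" where
  "problem_P n J q K A b c =
     \<lparr>nvars = n, idx = J, bdim = q, cone = K,
      slack = (\<lambda>j x. A j *\<^sub>v x - b j),
      adj = (\<lambda>j y. transpose_mat (A j) *\<^sub>v y),
      cost = c,
      dual_obj = (\<lambda>y. \<Sum>j\<in>J. b j \<bullet> y j)\<rparr>"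

definition problem_MP ::
  "nat \<Rightarrow> nat set \<Rightarrow> (nat \<Rightarrow> nat) \<Rightarrow> (nat \<Rightarrow> real vec set) \<Rightarrow>
   (nat \<Rightarrow> real mat) \<Rightarrow> (nat \<Rightarrow> real vec) \<Rightarrow> real vec \<Rightarrow> (nat \<Rightarrow> real mat) \<Rightarrow> problem" where
  "problem_MP n J p \<K> A b c M =
     \<lparr>nvars = n, idx = J, bdim = p, cone = \<K>,
      slack = (\<lambda>j x. M j *\<^sub>v (A j *\<^sub>v x - b j)),
      adj = (\<lambda>j z. transpose_mat (A j) *\<^sub>v (transpose_mat (M j) *\<^sub>v z)),
      cost = c,
      dual_obj = (\<lambda>z. \<Sum>j\<in>J. b j \<bullet> (transpose_mat (M j) *\<^sub>v z j))\<rparr>"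

definition primal_feasible :: "problem \<Rightarrow> real vec set" where
  "primal_feasible X = {x \<in> carrier_vec (nvars X). \<forall>j\<in>idx X. slack X j x \<in> cone X j}"

definition dual_feasible :: "problem \<Rightarrow> (nat \<Rightarrow> real vec) set" where
  "dual_feasible X =
     {y \<in> (\<Pi>\<^sub>E j\<in>idx X. dual_cone (bdim X j) (cone X j)).
        finsum_vec TYPE(real) (nvars X) (\<lambda>j. adj X j (y j)) (idx X) = cost X}"

definition primal_optimal :: "problem \<Rightarrow> real vec set" where
  "primal_optimal X =
     {x \<in> primal_feasible X. \<forall>x'\<in>primal_feasible X. cost X \<bullet> x \<le> cost X \<bullet> x'}"

definition dual_optimal :: "problem \<Rightarrow> (nat \<Rightarrow> real vec) set" where
  "dual_optimal X = {y \<in> dual_feasible X. \<forall>y'\<in>dual_feasible X. dual_obj X y' \<le> dual_obj X y}"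

definition strong_duality :: "problem \<Rightarrow> bool" where
  "strong_duality X \<longleftrightarrow>
     primal_optimal X \<noteq> {} \<and> dual_optimal X \<noteq> {} \<and>
     (\<forall>x\<in>primal_optimal X. \<forall>y\<in>dual_optimal X. cost X \<bullet> x = dual_obj X y)"

definition compl_solutions :: "problem \<Rightarrow> (real vec \<times> (nat \<Rightarrow> real vec)) set" where
  "compl_solutions X =
     {(x, y). x \<in> primal_feasible X \<and> y \<in> dual_feasible X \<and>
              (\<forall>j\<in>idx X. y j \<bullet> slack X j x = 0)}"

definition B_set :: "problem \<Rightarrow> nat set" where
  "B_set X = {j \<in> idx X. \<exists>(x, y)\<in>compl_solutions X.
     slack X j x \<in> (vec_topology (bdim X j)) interior_of (cone X j)}"

definition N_set :: "problem \<Rightarrow> nat set" where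
  "N_set X = {j \<in> idx X. \<exists>(x, y)\<in>compl_solutions X.
     y j \<in> (vec_topology (bdim X j)) interior_of (dual_cone (bdim X j) (cone X j))}"

definition B0_set :: "problem \<Rightarrow> nat set" where
  "B0_set X = {j \<in> idx X. \<forall>(x, y)\<in>compl_solutions X. y j = 0\<^sub>v (bdim X j)}"

definition N0_set :: "problem \<Rightarrow> nat set" where
  "N0_set X = {j \<in> idx X. \<forall>(x, y)\<in>compl_solutions X. slack X j x = 0\<^sub>v (bdim X j)}"

text \<open>The tuple \<open>(B, N, B', N', O, C)\<close>.\<close>

definition six_partition ::
  "problem \<Rightarrow> nat set \<times> nat set \<times> nat set \<times> nat set \<times> nat set \<times> nat set" where
  "six_partition X =
     (B_set X,
      N_set X,
      B0_set X - (N0_set X \<union> B_set X),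
      N0_set X - (B0_set X \<union> N_set X),
      B0_set X \<inter> N0_set X,
      idx X - (B0_set X \<union> N0_set X))"

end

theory Submission
  imports Defs
begin

text \<open>
  Everything rests on one identity: block by block, the dual cones satisfy \<open>K\<^sup>+ = M\<^sup>T L\<^sup>+\<close>, where
  \<open>L\<close> is the cone of the transformed problem, so that \<open>K\<close> is the preimage of \<open>L\<close> under \<open>M\<close>.
  The inclusion \<open>\<supseteq>\<close> is the adjoint relation \<open>(M\<^sup>T z) \<bullet> s = z \<bullet> (M s)\<close>.  For \<open>\<subseteq>\<close>, a point of \<open>K\<^sup>+\<close>
  outside the closed convex cone \<open>M\<^sup>T L\<^sup>+\<close> could be separated from it by some \<open>s\<close>; then \<open>M s\<close> is
  nonnegative on \<open>L\<^sup>+\<close>, hence lies in \<open>L\<close> by the bipolar theorem, so \<open>s \<in> K\<close>, a contradiction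
  (lemma \<open>dual_cone_eq_transpose_image\<close>).

  Consequently \<open>(x, z) \<mapsto> (x, M\<^sup>T z)\<close> maps the complementary solutions of the transformed problem onto
  those of the original one (lemma \<open>compl_solutions_MP_iff\<close>).  In particular both problems have
  the same primal parts \<open>x\<close>.  The sets \<open>B\<close> then agree because \<open>M\<close> preserves and reflects interior points of
  the cones, and the sets \<open>N\<^sup>0\<close> agree because \<open>M\<close> is injective.  Since \<open>M\<^sup>T 0 = 0\<close>, a block that vanishes
  for all \<open>z\<close> vanishes for all \<open>y\<close>; the converse is exactly what triviality of the kernel of \<open>M\<^sup>T\<close>
  on \<open>L\<^sup>+\<close> provides.

  The sets \<open>N\<close> require \<open>int K\<^sup>+ = M\<^sup>T (int L\<^sup>+)\<close> (lemma \<open>interior_dual_cone_eq_transpose_image\<close>).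
  Interior points of a dual cone are the vectors that are strictly positive on the nonzero elements of
  the cone, which gives \<open>\<supseteq>\<close> by injectivity.  Conversely, choose \<open>z\<^sub>0 \<in> int L\<^sup>+\<close>, which exists because
  \<open>L\<close> is pointed; if \<open>y \<in> int K\<^sup>+\<close>, then \<open>y - t M\<^sup>T z\<^sub>0\<close> is still in \<open>K\<^sup>+\<close> for some \<open>t > 0\<close>, hence
  equals \<open>M\<^sup>T z\<^sub>1\<close> with \<open>z\<^sub>1 \<in> L\<^sup>+\<close>, and \<open>y = M\<^sup>T (z\<^sub>1 + t z\<^sub>0)\<close> where \<open>z\<^sub>1 + t z\<^sub>0\<close> is an interior point.
\<close>

section \<open>The topology of coordinate space\<close>

text \<open>
  The vector topology is initial with respect to the coordinates.  This is the only place where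
  its construction as a pullback is unfolded; all later topological facts go through continuity of maps.
\<close>

lemma continuous_map_into_vec_topology:
  "continuous_map X (vec_topology n) f \<longleftrightarrow>
     f ` topspace X \<subseteq> carrier_vec n \<and> (\<forall>i<n. continuous_map X euclideanreal (\<lambda>x. f x $ i))"
  (is "?L \<longleftrightarrow> ?R")
proof
  assume L: ?L
  have "f ` topspace X \<subseteq> carrier_vec n"
    using continuous_map_image_subset_topspace[OF L] by simp
  moreover have "continuous_map (vec_topology n) euclideanreal (\<lambda>v. v $ i)" if "i < n" for i
  proof -
    have "continuous_map (Euclidean_space n) euclideanreal (\<lambda>g. g i)"
      unfolding Euclidean_space_def
      by (intro continuous_map_from_subtopology continuous_map_product_projection) simp
    then have "continuous_map (vec_topology n) euclideanreal
        ((\<lambda>g. g i) \<circ> (\<lambda>v i. if i < n then v $ i else 0))"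
      unfolding vec_topology_def by (rule continuous_map_pullback)
    with that show ?thesis by (simp add: o_def)
  qed
  then have "\<forall>i<n. continuous_map X euclideanreal (\<lambda>x. f x $ i)"
    using continuous_map_compose[OF L] by (auto simp: o_def)
  ultimately show ?R by blast
next
  assume R: ?R
  then have "continuous_map X (Euclidean_space n) (\<lambda>x i. if i < n then f x $ i else 0)"
    by (simp add: continuous_map_componentwise_Euclidean_space)
  with R show ?L
    unfolding vec_topology_def by (intro continuous_map_pullback') (auto simp: o_def)
qed

lemma continuous_map_vec_coord:
  "i < n \<Longrightarrow> continuous_map (vec_topology n) euclideanreal (\<lambda>v. v $ i)"
  using continuous_map_into_vec_topology[of "vec_topology n" n "\<lambda>v. v"] continuous_map_id
  by (auto simp: id_def)

lemma continuous_map_scalar_prod: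
  assumes f: "continuous_map X (vec_topology n) f" and g: "continuous_map X (vec_topology n) g"
  shows "continuous_map X euclideanreal (\<lambda>x. f x \<bullet> g x)"
proof (rule continuous_map_eq)
  show "continuous_map X euclideanreal (\<lambda>x. \<Sum>i<n. f x $ i * g x $ i)"
    using f g by (intro continuous_intros) (auto simp: continuous_map_into_vec_topology)
  show "(\<Sum>i<n. f x $ i * g x $ i) = f x \<bullet> g x" if "x \<in> topspace X" for x
    using g that by (auto simp: continuous_map_into_vec_topology scalar_prod_def
        image_subset_iff lessThan_atLeast0)
qed

lemma continuous_map_vec_diff_const:
  assumes a: "a \<in> carrier_vec n"
  shows "continuous_map (vec_topology n) (vec_topology n) (\<lambda>v. v - a)"
proof -
  have "continuous_map (vec_topology n) euclideanreal (\<lambda>v. (v - a) $ i)" if "i < n" for i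
  proof (rule continuous_map_eq)
    show "continuous_map (vec_topology n) euclideanreal (\<lambda>v. v $ i - a $ i)"
      using that by (intro continuous_intros continuous_map_vec_coord)
  qed (use a that in auto)
  with a show ?thesis by (auto simp: continuous_map_into_vec_topology)
qed

text \<open>
  Heine--Borel: the box \<open>[-R, R]\<^sup>n\<close> is a continuous image of a product of compact intervals, and
  a closed subset of it is compact.
\<close>

lemma compactin_vec_topology:
  assumes C: "closedin (vec_topology n) C" and bd: "\<And>v i. v \<in> C \<Longrightarrow> i < n \<Longrightarrow> \<bar>v $ i\<bar> \<le> R"
  shows "compactin (vec_topology n) C"
proof (rule closed_compactin[OF _ _ C])
  let ?box = "\<Pi>\<^sub>E i\<in>{..<n}. {-R..R}"
  have "compactin (product_topology (\<lambda>i. euclideanreal) {..<n}) ?box"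
    by (simp add: compactin_PiE)
  moreover have "continuous_map (product_topology (\<lambda>i. euclideanreal) {..<n}) (vec_topology n) (vec n)"
  proof -
    have "continuous_map (product_topology (\<lambda>i. euclideanreal) {..<n}) euclideanreal (\<lambda>x. vec n x $ i)"
      if "i < n" for i
      using that continuous_map_product_projection[of i "{..<n}" "\<lambda>i. euclideanreal"] by simp
    then show ?thesis by (auto simp: continuous_map_into_vec_topology)
  qed
  ultimately show "compactin (vec_topology n) (vec n ` ?box)"
    by (rule image_compactin)
  have "C \<subseteq> carrier_vec n" using closedin_subset[OF C] by simp
  show "C \<subseteq> vec n ` ?box"
  proof
    fix v assume v: "v \<in> C"
    show "v \<in> vec n ` ?box"
    proof (rule image_eqI)
      show "v = vec n (\<lambda>i\<in>{..<n}. v $ i)"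
        using v \<open>C \<subseteq> carrier_vec n\<close> by (intro eq_vecI) auto
      show "(\<lambda>i\<in>{..<n}. v $ i) \<in> ?box" using bd[OF v] by (auto simp: abs_le_iff minus_le_iff)
    qed
  qed
qed

lemma compactin_attains_inf:
  fixes f :: "'a \<Rightarrow> real"
  assumes "compactin X S" "S \<noteq> {}" "continuous_map X euclideanreal f"
  shows "\<exists>x\<in>S. \<forall>y\<in>S. f x \<le> f y"
proof -
  have "compact (f ` S)"
    using image_compactin[OF assms(1,3)] by simp
  with assms(2) show ?thesis
    using compact_attains_inf[of "f ` S"] by auto
qed

lemma coord_square_le_scalar_prod:
  fixes v :: "real vec"
  assumes "v \<in> carrier_vec n" "i < n"
  shows "(v $ i)\<^sup>2 \<le> v \<bullet> v"
  using assms member_le_sum[of i "{0..<n}" "\<lambda>i. v $ i * v $ i"]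
  by (simp add: scalar_prod_def power2_eq_square)

lemma scalar_prod_self_pos:
  fixes v :: "real vec"
  assumes "v \<in> carrier_vec n" "v \<noteq> 0\<^sub>v n"
  shows "v \<bullet> v > 0"
proof -
  obtain i where "i < n" "v $ i \<noteq> 0" using assms by (metis carrier_vecD eq_vecI index_zero_vec)
  with coord_square_le_scalar_prod[OF assms(1), of i] show ?thesis
    by (smt (verit) zero_less_power2)
qed

lemma scalar_prod_add_smult_self:
  fixes s d :: "real vec"
  assumes "s \<in> carrier_vec n" "d \<in> carrier_vec n"
  shows "(s + t \<cdot>\<^sub>v d) \<bullet> (s + t \<cdot>\<^sub>v d) = s \<bullet> s + 2 * t * (s \<bullet> d) + t\<^sup>2 * (d \<bullet> d)"
  using assms
  by (simp add: scalar_prod_def sum_distrib_left flip: sum.distrib)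
    (simp add: algebra_simps power2_eq_square)

text \<open>
  From an interior point one can step a little in every direction, because the line
  \<open>t \<mapsto> z - t d\<close> is continuous.
\<close>

lemma interior_of_vec_topology_step:
  assumes z: "z \<in> (vec_topology n) interior_of D" and d: "d \<in> carrier_vec n"
  obtains t where "t > 0" "z - t \<cdot>\<^sub>v d \<in> D"
proof -
  have zc: "z \<in> carrier_vec n"
    using z interior_of_subset_topspace[of "vec_topology n" D] by auto
  have "continuous_map euclideanreal euclideanreal (\<lambda>t. (z - t \<cdot>\<^sub>v d) $ i)" if "i < n" for i
  proof (rule continuous_map_eq)
    show "continuous_map euclideanreal euclideanreal (\<lambda>t. z $ i - t * d $ i)"
      by (simp add: continuous_intros)
  qed (use zc d that in auto)
  then have cont: "continuous_map euclideanreal (vec_topology n) (\<lambda>t. z - t \<cdot>\<^sub>v d)"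
    using zc d by (auto simp: continuous_map_into_vec_topology)
  let ?T = "{t. z - t \<cdot>\<^sub>v d \<in> (vec_topology n) interior_of D}"
  have "open ?T"
    using openin_continuous_map_preimage[OF cont openin_interior_of, of D] by simp
  moreover have "z - 0 \<cdot>\<^sub>v d = z" using zc d by auto
  then have "0 \<in> ?T" using z by simp
  ultimately obtain e where e: "e > 0" "\<And>t. dist t 0 < e \<Longrightarrow> t \<in> ?T"
    unfolding open_dist by blast
  then have "z - (e / 2) \<cdot>\<^sub>v d \<in> (vec_topology n) interior_of D" using e(2)[of "e / 2"] by simp
  with e(1) show ?thesis using that[of "e / 2"] interior_of_subset by fastforce
qed

section \<open>Closed convex cones and their duals\<close>

text \<open>
  For a set closed under scaling, convexity amounts to closure under addition; this form suits
  both the given regular cones and the linear images of dual cones.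
\<close>

definition closed_convex_cone :: "nat \<Rightarrow> real vec set \<Rightarrow> bool" where
  "closed_convex_cone n C \<longleftrightarrow>
     closedin (vec_topology n) C \<and> 0\<^sub>v n \<in> C \<and>
     (\<forall>u\<in>C. \<forall>t\<ge>0. t \<cdot>\<^sub>v u \<in> C) \<and> (\<forall>u\<in>C. \<forall>v\<in>C. u + v \<in> C)"

lemma closed_convex_cone_carrier: "closed_convex_cone n C \<Longrightarrow> C \<subseteq> carrier_vec n"
  unfolding closed_convex_cone_def using closedin_subset by fastforce

lemma regular_cone_closed_convex_cone:
  assumes "regular_cone n C"
  shows "closed_convex_cone n C"
proof -
  have C: "C \<subseteq> carrier_vec n" "\<And>u t. u \<in> C \<Longrightarrow> t \<ge> 0 \<Longrightarrow> t \<cdot>\<^sub>v u \<in> C"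
      "\<And>u v t. u \<in> C \<Longrightarrow> v \<in> C \<Longrightarrow> t \<in> {0..1} \<Longrightarrow> (1 - t) \<cdot>\<^sub>v u + t \<cdot>\<^sub>v v \<in> C"
      "(vec_topology n) interior_of C \<noteq> {}"
    using assms by (auto simp: regular_cone_def)
  obtain u where u: "u \<in> C" using C(4) interior_of_subset by fastforce
  have "0\<^sub>v n = 0 \<cdot>\<^sub>v u" using u C(1) by (intro eq_vecI) auto
  then have "0\<^sub>v n \<in> C" using C(2)[OF u, of 0] by simp
  moreover have "u + v \<in> C" if "u \<in> C" "v \<in> C" for u v
  proof -
    \<comment> \<open>The sum is twice the midpoint.\<close>
    have "(1 - 1/2) \<cdot>\<^sub>v u + (1/2) \<cdot>\<^sub>v v \<in> C" using that C(3)[of u v "1/2"] by simp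
    then have "2 \<cdot>\<^sub>v ((1 - 1/2) \<cdot>\<^sub>v u + (1/2) \<cdot>\<^sub>v v) \<in> C" by (rule C(2)) simp
    also have "2 \<cdot>\<^sub>v ((1 - 1/2) \<cdot>\<^sub>v u + (1/2) \<cdot>\<^sub>v v) = u + v"
    proof -
      have "u \<in> carrier_vec n" "v \<in> carrier_vec n" using that C(1) by auto
      then show ?thesis by (intro eq_vecI) auto
    qed
    finally show ?thesis .
  qed
  moreover have "closedin (vec_topology n) C" using assms by (simp add: regular_cone_def)
  ultimately show ?thesis
    unfolding closed_convex_cone_def using C(2) by blast
qed

lemma dual_cone_add:
  assumes "C \<subseteq> carrier_vec n" "y \<in> dual_cone n C" "z \<in> dual_cone n C"
  shows "y + z \<in> dual_cone n C"
  using assms by (auto simp: dual_cone_def add_scalar_prod_distrib[of _ n] subset_iff)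

lemma dual_cone_smult:
  assumes "C \<subseteq> carrier_vec n" "y \<in> dual_cone n C" "t \<ge> 0"
  shows "t \<cdot>\<^sub>v y \<in> dual_cone n C"
  using assms by (auto simp: dual_cone_def subset_iff)

lemma zero_in_dual_cone: "C \<subseteq> carrier_vec n \<Longrightarrow> 0\<^sub>v n \<in> dual_cone n C"
  by (auto simp: dual_cone_def subset_iff)

text \<open>
  First-order condition for a minimum at the left end of \<open>[0, 1]\<close>: dividing by \<open>t > 0\<close> and letting
  \<open>t\<close> tend to \<open>0\<close> leaves \<open>2 a \<ge> 0\<close>.
\<close>

lemma nonneg_of_quadratic_nonneg:
  fixes a q :: real
  assumes "\<And>t. 0 \<le> t \<Longrightarrow> t \<le> 1 \<Longrightarrow> 0 \<le> 2 * t * a + t\<^sup>2 * q" and "q \<ge> 0"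
  shows "a \<ge> 0"
proof (rule ccontr)
  assume "\<not> a \<ge> 0"
  then have a: "a < 0" by simp
  \<comment> \<open>Chosen so that \<open>t * q < - a\<close>: the linear term \<open>2 * t * a\<close> then outweighs \<open>t\<^sup>2 * q\<close>.\<close>
  define t where "t = - a / (q - a)"
  have t: "0 < t" "t \<le> 1" using a assms(2) by (auto simp: t_def field_simps)
  have "t * q < - a"
  proof -
    have "- a * q < - a * (q - a)" using a by (intro mult_strict_left_mono) auto
    then show ?thesis using a assms(2) by (simp add: t_def field_simps)
  qed
  then have "t * (2 * a + t * q) < 0" using t a by (intro mult_pos_neg) auto
  then show False using assms(1)[of t] t by (simp add: power2_eq_square algebra_simps)
qed

text \<open>
  The separating functional is \<open>s = c\<^sub>0 - y\<close> with \<open>c\<^sub>0\<close> the point of \<open>C\<close> closest to \<open>y\<close>.  Moving \<open>c\<^sub>0\<close> within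
  \<open>C\<close> towards \<open>c\<^sub>0 + c\<close> does not decrease the distance, so \<open>s \<bullet> c \<ge> 0\<close>; moving it towards \<open>0\<close> does not
  either, so \<open>s \<bullet> c\<^sub>0 \<le> 0\<close> and \<open>s \<bullet> y = s \<bullet> c\<^sub>0 - s \<bullet> s < 0\<close>.
\<close>

lemma closed_convex_cone_separation:
  assumes C: "closed_convex_cone n C" and y: "y \<in> carrier_vec n" "y \<notin> C"
  obtains s where "s \<in> carrier_vec n" "s \<bullet> y < 0" "\<And>c. c \<in> C \<Longrightarrow> 0 \<le> s \<bullet> c"
proof -
  note Cc = closed_convex_cone_carrier[OF C]
  let ?f = "\<lambda>v. (v - y) \<bullet> (v - y)"
  have cont: "continuous_map (vec_topology n) euclideanreal ?f"
    by (intro continuous_map_scalar_prod[where n = n] continuous_map_vec_diff_const y)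
  \<comment> \<open>Points of \<open>C\<close> farther from \<open>y\<close> than \<open>0 \<in> C\<close> cannot be closest, so a compact part of \<open>C\<close> suffices.\<close>
  let ?S = "{v \<in> C. ?f v \<in> {.. y \<bullet> y}}"
  have "compactin (vec_topology n) ?S"
  proof (rule compactin_vec_topology)
    show "closedin (vec_topology n) ?S"
      using C by (intro closedin_continuous_map_preimage_gen[OF cont])
        (auto simp: closed_convex_cone_def)
  next
    fix v i assume v: "v \<in> ?S" and i: "i < n"
    have "(y $ i)\<^sup>2 \<le> y \<bullet> y" "((v - y) $ i)\<^sup>2 \<le> y \<bullet> y"
      using coord_square_le_scalar_prod[of y n i] coord_square_le_scalar_prod[of "v - y" n i] v y i Cc
      by (auto intro: order_trans)
    then have "\<bar>y $ i\<bar> \<le> sqrt (y \<bullet> y)" "\<bar>(v - y) $ i\<bar> \<le> sqrt (y \<bullet> y)"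
      by (simp_all only: real_le_rsqrt power2_abs)
    moreover have "(v - y) $ i = v $ i - y $ i" using v y i Cc by auto
    ultimately show "\<bar>v $ i\<bar> \<le> 2 * sqrt (y \<bullet> y)" by linarith
  qed
  moreover have "0\<^sub>v n \<in> ?S"
    using C y by (auto simp: closed_convex_cone_def)
  ultimately obtain c0 where c0: "c0 \<in> ?S" "\<And>v. v \<in> ?S \<Longrightarrow> ?f c0 \<le> ?f v"
    using compactin_attains_inf[OF _ _ cont, of ?S] by blast
  have closest: "?f c0 \<le> ?f v" if "v \<in> C" for v
    using c0 that by (cases "v \<in> ?S") auto
  define s where "s = c0 - y"
  have c0c: "c0 \<in> carrier_vec n" and s: "s \<in> carrier_vec n" using c0(1) Cc y by (auto simp: s_def)
  have variation: "0 \<le> s \<bullet> d"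
    if d: "d \<in> carrier_vec n" and in_C: "\<And>t. 0 \<le> t \<Longrightarrow> t \<le> 1 \<Longrightarrow> c0 + t \<cdot>\<^sub>v d \<in> C" for d
  proof (rule nonneg_of_quadratic_nonneg)
    show "0 \<le> d \<bullet> d" using scalar_prod_self_pos[OF d] d by (cases "d = 0\<^sub>v n") auto
    fix t :: real assume t: "0 \<le> t" "t \<le> 1"
    have "c0 + t \<cdot>\<^sub>v d - y = s + t \<cdot>\<^sub>v d"
      using c0c d y by (intro eq_vecI) (auto simp: s_def)
    with closest[OF in_C[OF t]] show "0 \<le> 2 * t * (s \<bullet> d) + t\<^sup>2 * (d \<bullet> d)"
      by (simp add: scalar_prod_add_smult_self[OF s d] flip: s_def)
  qed
  have nonneg: "0 \<le> s \<bullet> c" if "c \<in> C" for c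
    using that c0(1) C Cc by (intro variation) (auto simp: closed_convex_cone_def)
  have "0 \<le> s \<bullet> (- c0)"
  proof (rule variation)
    fix t :: real assume t: "0 \<le> t" "t \<le> 1"
    have "c0 + t \<cdot>\<^sub>v (- c0) = (1 - t) \<cdot>\<^sub>v c0"
      using c0c by (intro eq_vecI) (auto simp: algebra_simps)
    then show "c0 + t \<cdot>\<^sub>v (- c0) \<in> C" using C c0(1) t by (auto simp: closed_convex_cone_def)
  qed (use c0c in auto)
  then have "s \<bullet> c0 \<le> 0" using s c0c by simp
  moreover have "s \<bullet> s = s \<bullet> c0 - s \<bullet> y"
    using scalar_prod_minus_distrib[OF s c0c y(1)] by (simp add: s_def)
  moreover have "s \<noteq> 0\<^sub>v n"
  proof
    assume "s = 0\<^sub>v n"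
    then have "s $ i = 0" if "i < n" for i using that by simp
    then have "c0 = y" using c0c y by (intro eq_vecI) (auto simp: s_def)
    then show False using y c0(1) by auto
  qed
  then have "0 < s \<bullet> s" using scalar_prod_self_pos[OF s] by simp
  ultimately have "s \<bullet> y < 0" by linarith
  then show ?thesis using that[OF s] nonneg by blast
qed

text \<open>
  The bipolar theorem \<open>C\<^sup>+\<^sup>+ = C\<close>.
\<close>

lemma mem_closed_convex_cone_iff_dual:
  assumes C: "closed_convex_cone n C" and u: "u \<in> carrier_vec n"
  shows "u \<in> C \<longleftrightarrow> (\<forall>z\<in>dual_cone n C. 0 \<le> z \<bullet> u)"
proof
  assume R: "\<forall>z\<in>dual_cone n C. 0 \<le> z \<bullet> u"
  show "u \<in> C"
  proof (rule ccontr)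
    assume "u \<notin> C"
    then obtain s where "s \<in> carrier_vec n" "s \<bullet> u < 0" "\<And>c. c \<in> C \<Longrightarrow> 0 \<le> s \<bullet> c"
      using closed_convex_cone_separation[OF C u] by blast
    with R show False by (fastforce simp: dual_cone_def)
  qed
qed (auto simp: dual_cone_def)

text \<open>
  A compact base of the cone.  The sum of absolute values, rather than the Euclidean norm, makes the
  estimate of \<open>\<bar>(w - z) \<bullet> v\<bar>\<close> over the base a coordinatewise one.
\<close>

definition l1_slice :: "nat \<Rightarrow> real vec set \<Rightarrow> real vec set" where
  "l1_slice n C = {v \<in> C. (\<Sum>i<n. \<bar>v $ i\<bar>) = 1}"

lemma compactin_l1_slice:
  assumes "closed_convex_cone n C"
  shows "compactin (vec_topology n) (l1_slice n C)"
proof (rule compactin_vec_topology)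
  have "continuous_map (vec_topology n) euclideanreal (\<lambda>v. \<Sum>i<n. \<bar>v $ i\<bar>)"
    by (intro continuous_intros continuous_map_vec_coord) auto
  from closedin_continuous_map_preimage_gen[OF this, of C "{1}"] assms
  show "closedin (vec_topology n) (l1_slice n C)"
    by (simp add: l1_slice_def closed_convex_cone_def)
  show "\<bar>v $ i\<bar> \<le> 1" if "v \<in> l1_slice n C" "i < n" for v i
    using that member_le_sum[of i "{..<n}" "\<lambda>i. \<bar>v $ i\<bar>"] by (simp add: l1_slice_def)
qed

lemma closed_convex_cone_l1_sliceE:
  assumes C: "closed_convex_cone n C" and u: "u \<in> C" "u \<noteq> 0\<^sub>v n"
  obtains t v where "t > 0" "v \<in> l1_slice n C" "u = t \<cdot>\<^sub>v v"
proof -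
  have uc: "u \<in> carrier_vec n" using closed_convex_cone_carrier[OF C] u by auto
  then obtain i where i: "i < n" "u $ i \<noteq> 0" using u by (metis carrier_vecD eq_vecI index_zero_vec)
  let ?t = "\<Sum>i<n. \<bar>u $ i\<bar>"
  have t: "?t > 0" using i by (intro sum_pos2[of _ i]) auto
  have "(1 / ?t) \<cdot>\<^sub>v u \<in> C" using C u t by (auto simp: closed_convex_cone_def)
  moreover have "(\<Sum>i<n. \<bar>((1 / ?t) \<cdot>\<^sub>v u) $ i\<bar>) = (\<Sum>i<n. \<bar>u $ i\<bar> / ?t)"
    using uc t by (intro sum.cong) (auto simp: abs_mult abs_divide)
  ultimately have "(1 / ?t) \<cdot>\<^sub>v u \<in> l1_slice n C"
    using t by (simp add: l1_slice_def flip: sum_divide_distrib)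
  moreover have "u = ?t \<cdot>\<^sub>v ((1 / ?t) \<cdot>\<^sub>v u)" using uc t by (intro eq_vecI) auto
  ultimately show ?thesis using t that by blast
qed

lemma l1_slice_nonzero: "v \<in> l1_slice n C \<Longrightarrow> v \<noteq> 0\<^sub>v n"
  by (auto simp: l1_slice_def)

text \<open>
  A point \<open>z\<close> that is strictly positive on \<open>C - {0}\<close> is bounded below by some \<open>m > 0\<close> on the compact
  base, and every \<open>w\<close> with all coordinates within \<open>m\<close> of those of \<open>z\<close> stays nonnegative there, hence on \<open>C\<close>.
  Conversely, if \<open>z\<close> is interior, then \<open>z - t u\<close> is in the dual cone for some \<open>t > 0\<close>, so that
  \<open>z \<bullet> u \<ge> t (u \<bullet> u)\<close>.
\<close>

lemma interior_dual_cone: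
  assumes C: "closed_convex_cone n C"
  shows "(vec_topology n) interior_of (dual_cone n C) =
    {z \<in> carrier_vec n. \<forall>u\<in>C. u \<noteq> 0\<^sub>v n \<longrightarrow> 0 < z \<bullet> u}" (is "_ = ?R")
proof
  note Cc = closed_convex_cone_carrier[OF C]
  show "(vec_topology n) interior_of (dual_cone n C) \<subseteq> ?R"
  proof
    fix z assume z: "z \<in> (vec_topology n) interior_of (dual_cone n C)"
    then have zc: "z \<in> carrier_vec n"
      using interior_of_subset_topspace[of "vec_topology n"] by fastforce
    moreover have "0 < z \<bullet> u" if u: "u \<in> C" "u \<noteq> 0\<^sub>v n" for u
    proof -
      have uc: "u \<in> carrier_vec n" using u Cc by auto
      obtain t where t: "t > 0" "z - t \<cdot>\<^sub>v u \<in> dual_cone n C"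
        using interior_of_vec_topology_step[OF z uc] by blast
      then have "0 \<le> (z - t \<cdot>\<^sub>v u) \<bullet> u" using u by (auto simp: dual_cone_def)
      also have "\<dots> = z \<bullet> u - t * (u \<bullet> u)"
        using zc uc by (simp add: minus_scalar_prod_distrib[of _ n])
      finally show ?thesis using t(1) scalar_prod_self_pos[OF uc u(2)]
        by (smt (verit) mult_pos_pos)
    qed
    ultimately show "z \<in> ?R" by blast
  qed
next
  note Cc = closed_convex_cone_carrier[OF C]
  show "?R \<subseteq> (vec_topology n) interior_of (dual_cone n C)"
  proof
    fix z assume z: "z \<in> ?R"
    let ?S = "l1_slice n C"
    have pos: "0 < z \<bullet> v" if "v \<in> ?S" for v
      using z that l1_slice_nonzero[OF that] by (auto simp: l1_slice_def)
    have "continuous_map (vec_topology n) euclideanreal (\<lambda>v. z \<bullet> v)"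
      using z by (intro continuous_map_scalar_prod[where n = n]) (auto intro: continuous_map_id[unfolded id_def])
    then obtain m where m: "m > 0" "\<And>v. v \<in> ?S \<Longrightarrow> m \<le> z \<bullet> v"
    proof (cases "?S = {}")
      case False
      with \<open>continuous_map _ _ _\<close> obtain v0 where "v0 \<in> ?S" "\<forall>v\<in>?S. z \<bullet> v0 \<le> z \<bullet> v"
        using compactin_attains_inf[OF compactin_l1_slice[OF C]] by blast
      then show ?thesis using that[of "z \<bullet> v0"] pos by blast
    qed (use that[of 1] in auto)
    let ?U = "{w \<in> topspace (vec_topology n). (\<Sum>i<n. \<bar>w $ i - z $ i\<bar>) \<in> {..<m}}"
    have "continuous_map (vec_topology n) euclideanreal (\<lambda>w. \<Sum>i<n. \<bar>w $ i - z $ i\<bar>)"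
      by (intro continuous_intros continuous_map_vec_coord) auto
    then have "openin (vec_topology n) ?U"
      by (rule openin_continuous_map_preimage) auto
    moreover have "?U \<subseteq> dual_cone n C"
    proof
      fix w assume w: "w \<in> ?U"
      then have wc: "w \<in> carrier_vec n" by simp
      have "0 \<le> w \<bullet> v" if v: "v \<in> ?S" for v
      proof -
        have vc: "v \<in> carrier_vec n" using v Cc by (auto simp: l1_slice_def)
        have "z \<bullet> v - w \<bullet> v = (\<Sum>i<n. (z $ i - w $ i) * v $ i)"
          using vc by (simp add: scalar_prod_def lessThan_atLeast0 algebra_simps sum_subtractf)
        also have "\<dots> \<le> (\<Sum>i<n. m * \<bar>v $ i\<bar>)"
        proof (rule sum_mono)
          fix i assume i: "i \<in> {..<n}"
          have "\<bar>w $ i - z $ i\<bar> \<le> m"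
            using member_le_sum[OF i, of "\<lambda>i. \<bar>w $ i - z $ i\<bar>"] w by simp
          then have "\<bar>z $ i - w $ i\<bar> * \<bar>v $ i\<bar> \<le> m * \<bar>v $ i\<bar>"
            by (intro mult_right_mono) auto
          then show "(z $ i - w $ i) * v $ i \<le> m * \<bar>v $ i\<bar>"
            by (simp flip: abs_mult)
        qed
        also have "\<dots> = m" using v by (simp add: l1_slice_def flip: sum_distrib_left)
        finally show ?thesis using m(2)[OF v] by simp
      qed
      then have "0 \<le> w \<bullet> u" if u: "u \<in> C" for u
      proof (cases "u = 0\<^sub>v n")
        case False
        then obtain t v where tv: "t > 0" "v \<in> ?S" "u = t \<cdot>\<^sub>v v"
          using closed_convex_cone_l1_sliceE[OF C u] by blast
        moreover from tv have "v \<in> carrier_vec n" using Cc by (auto simp: l1_slice_def)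
        ultimately show ?thesis using wc \<open>\<And>v. v \<in> ?S \<Longrightarrow> 0 \<le> w \<bullet> v\<close>[of v] by simp
      qed (use wc in simp)
      then show "w \<in> dual_cone n C" using wc by (simp add: dual_cone_def)
    qed
    ultimately have "?U \<subseteq> (vec_topology n) interior_of (dual_cone n C)"
      by (simp add: interior_of_maximal)
    then show "z \<in> (vec_topology n) interior_of (dual_cone n C)" using z m(1) by auto
  qed
qed

text \<open>
  For \<open>v\<close> in the base of a pointed cone \<open>C\<close> we have \<open>- v \<notin> C\<close>, so by the bipolar theorem some
  \<open>z \<in> C\<^sup>+\<close> is positive at \<open>v\<close>.  By compactness the open sets \<open>{v. 0 < z \<bullet> v}\<close> for finitely many such
  \<open>z\<close> cover the base, and the sum of these \<open>z\<close> is positive on all of it.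
\<close>

lemma interior_dual_cone_nonempty:
  assumes C: "closed_convex_cone n C" and pointed: "\<And>u. u \<in> C \<Longrightarrow> - u \<in> C \<Longrightarrow> u = 0\<^sub>v n"
  shows "(vec_topology n) interior_of (dual_cone n C) \<noteq> {}"
proof -
  note Cc = closed_convex_cone_carrier[OF C]
  let ?S = "l1_slice n C"
  let ?U = "\<lambda>z. {v \<in> topspace (vec_topology n). z \<bullet> v \<in> {0<..}}"
  have cover: "\<exists>z\<in>dual_cone n C. 0 < z \<bullet> v" if v: "v \<in> ?S" for v
  proof -
    have vC: "v \<in> C" and vc: "v \<in> carrier_vec n" using v Cc by (auto simp: l1_slice_def)
    then have "- v \<notin> C" using pointed l1_slice_nonzero[OF v] by blast
    then obtain z where z: "z \<in> dual_cone n C" "z \<bullet> (- v) < 0"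
      using mem_closed_convex_cone_iff_dual[OF C, of "- v"] vc by force
    moreover have "z \<in> carrier_vec n" using z by (simp add: dual_cone_def)
    ultimately show ?thesis using vc by auto
  qed
  have open_U: "openin (vec_topology n) (?U z)" if "z \<in> dual_cone n C" for z
    using that by (intro openin_continuous_map_preimage[where Y = euclideanreal]
        continuous_map_scalar_prod[where n = n]) (auto simp: dual_cone_def intro: continuous_map_id[unfolded id_def])
  have "?S \<subseteq> \<Union> (?U ` dual_cone n C)" using cover Cc by (fastforce simp: l1_slice_def)
  then obtain \<F> where \<F>: "finite \<F>" "\<F> \<subseteq> ?U ` dual_cone n C" "?S \<subseteq> \<Union> \<F>"
    using compactinD[OF compactin_l1_slice[OF C], of "?U ` dual_cone n C"] open_U by auto
  obtain F where F: "finite F" "F \<subseteq> dual_cone n C" "\<F> = ?U ` F"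
    using finite_subset_image[OF \<F>(1,2)] by blast
  \<comment> \<open>The sum over \<open>F\<close>, built up by induction: on \<open>C\<close> it is positive wherever one of its summands is.\<close>
  have "\<exists>z\<in>dual_cone n C. \<forall>v\<in>C. (\<exists>w\<in>F. 0 < w \<bullet> v) \<longrightarrow> 0 < z \<bullet> v"
    using F(1,2)
  proof (induction F)
    case empty
    then show ?case using zero_in_dual_cone[OF Cc] by auto
  next
    case (insert w F)
    then obtain z where z: "z \<in> dual_cone n C" "\<forall>v\<in>C. (\<exists>w\<in>F. 0 < w \<bullet> v) \<longrightarrow> 0 < z \<bullet> v" by auto
    have w: "w \<in> dual_cone n C" using insert by auto
    have "0 < (w + z) \<bullet> v" if v: "v \<in> C" "\<exists>w'\<in>insert w F. 0 < w' \<bullet> v" for v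
    proof -
      have "(w + z) \<bullet> v = w \<bullet> v + z \<bullet> v"
        using w z(1) v Cc by (intro add_scalar_prod_distrib[of _ n]) (auto simp: dual_cone_def)
      moreover have "0 \<le> w \<bullet> v" "0 \<le> z \<bullet> v" using w z(1) v by (auto simp: dual_cone_def)
      ultimately show ?thesis using v z(2) by force
    qed
    then show ?case using dual_cone_add[OF Cc w z(1)] by blast
  qed
  then obtain z where z: "z \<in> dual_cone n C" "\<forall>v\<in>C. (\<exists>w\<in>F. 0 < w \<bullet> v) \<longrightarrow> 0 < z \<bullet> v" by auto
  then have zc: "z \<in> carrier_vec n" by (simp add: dual_cone_def)
  have "0 < z \<bullet> u" if u: "u \<in> C" "u \<noteq> 0\<^sub>v n" for u
  proof -
    obtain t v where tv: "t > 0" "v \<in> ?S" "u = t \<cdot>\<^sub>v v"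
      using closed_convex_cone_l1_sliceE[OF C u] by blast
    then have "0 < z \<bullet> v" "v \<in> carrier_vec n" using F(3) \<F>(3) z(2) Cc by (auto simp: l1_slice_def)
    then show ?thesis using tv zc by simp
  qed
  then show ?thesis using zc unfolding interior_dual_cone[OF C] by blast
qed

section \<open>The dual of the preimage of a cone under a linear map\<close>

lemma transpose_mult_scalar_prod:
  fixes M :: "real mat"
  assumes "M \<in> carrier_mat p q" "z \<in> carrier_vec p" "s \<in> carrier_vec q"
  shows "(transpose_mat M *\<^sub>v z) \<bullet> s = z \<bullet> (M *\<^sub>v s)"
  using transpose_vec_mult_scalar[OF assms(1,3,2)] .

lemma transpose_dual_cone_subset:
  assumes M: "M \<in> carrier_mat p q" and K: "K \<subseteq> carrier_vec q"
    and "\<And>s. s \<in> K \<Longrightarrow> M *\<^sub>v s \<in> L"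
  shows "(*\<^sub>v) (transpose_mat M) ` dual_cone p L \<subseteq> dual_cone q K"
  using assms by (auto simp: dual_cone_def transpose_mult_scalar_prod[OF M] subset_iff)

text \<open>
  Farkas' lemma for the system \<open>M s \<in> L\<close>: closedness of the image is what allows a vector outside it
  to be separated, and the bipolar theorem turns the separating \<open>s\<close> into an element of \<open>K\<close>.
\<close>

lemma dual_cone_eq_transpose_image:
  assumes M: "M \<in> carrier_mat p q" and K: "K \<subseteq> carrier_vec q" and L: "closed_convex_cone p L"
    and mem_iff: "\<And>s. s \<in> carrier_vec q \<Longrightarrow> s \<in> K \<longleftrightarrow> M *\<^sub>v s \<in> L"
    and closed: "closedin (vec_topology q) ((*\<^sub>v) (transpose_mat M) ` dual_cone p L)"
  shows "dual_cone q K = (*\<^sub>v) (transpose_mat M) ` dual_cone p L" (is "_ = ?I")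
proof
  note Lc = closed_convex_cone_carrier[OF L]
  have Mt: "transpose_mat M \<in> carrier_mat q p" using M by simp
  show "?I \<subseteq> dual_cone q K"
    using mem_iff K by (intro transpose_dual_cone_subset[OF M K]) auto
  have dc: "z \<in> carrier_vec p" if "z \<in> dual_cone p L" for z using that by (simp add: dual_cone_def)
  have I: "closed_convex_cone q ?I"
    unfolding closed_convex_cone_def
  proof (intro conjI ballI allI impI)
    have "0\<^sub>v q = transpose_mat M *\<^sub>v 0\<^sub>v p" using M by auto
    then show "0\<^sub>v q \<in> ?I" using zero_in_dual_cone[OF Lc] by blast
    show "t \<cdot>\<^sub>v u \<in> ?I" if "u \<in> ?I" "0 \<le> t" for u t
      using that dual_cone_smult[OF Lc] dc mult_mat_vec[OF Mt] by (smt (verit) image_iff)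
    show "u + v \<in> ?I" if "u \<in> ?I" "v \<in> ?I" for u v
      using that dual_cone_add[OF Lc] dc mult_add_distrib_mat_vec[OF Mt] by (smt (verit) image_iff)
  qed (rule closed)
  show "dual_cone q K \<subseteq> ?I"
  proof (rule subsetI, rule ccontr)
    fix y assume y: "y \<in> dual_cone q K" and "y \<notin> ?I"
    then have yc: "y \<in> carrier_vec q" by (simp add: dual_cone_def)
    then obtain s where s: "s \<in> carrier_vec q" "s \<bullet> y < 0" "\<And>c. c \<in> ?I \<Longrightarrow> 0 \<le> s \<bullet> c"
      using closed_convex_cone_separation[OF I _ \<open>y \<notin> ?I\<close>] by blast
    have "0 \<le> z \<bullet> (M *\<^sub>v s)" if "z \<in> dual_cone p L" for z
    proof -
      have "0 \<le> s \<bullet> (transpose_mat M *\<^sub>v z)" using s(3) that by blast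
      also have "\<dots> = (transpose_mat M *\<^sub>v z) \<bullet> s"
        using dc[OF that] s(1) M by (intro comm_scalar_prod[of _ q]) auto
      also have "\<dots> = z \<bullet> (M *\<^sub>v s)" by (rule transpose_mult_scalar_prod[OF M dc[OF that] s(1)])
      finally show ?thesis .
    qed
    then have "M *\<^sub>v s \<in> L" using mem_closed_convex_cone_iff_dual[OF L, of "M *\<^sub>v s"] M s(1) by auto
    then have "s \<in> K" using mem_iff s(1) by blast
    then have "0 \<le> y \<bullet> s" using y by (auto simp: dual_cone_def)
    with s(2) show False using comm_scalar_prod[OF yc s(1)] by simp
  qed
qed

text \<open>
  The inclusion from left to right is an instance of the rule that a linear map sends the relative
  interior of a convex set onto that of its image: subtracting a multiple of an interior image point leaves
  room to add an interior point to an arbitrary preimage.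
\<close>

lemma interior_dual_cone_eq_transpose_image:
  assumes M: "M \<in> carrier_mat p q" and K: "closed_convex_cone q K" and L: "closed_convex_cone p L"
    and pointed: "\<And>u. u \<in> L \<Longrightarrow> - u \<in> L \<Longrightarrow> u = 0\<^sub>v p"
    and into: "\<And>s. s \<in> K \<Longrightarrow> M *\<^sub>v s \<in> L"
    and ker: "\<And>s. s \<in> K \<Longrightarrow> M *\<^sub>v s = 0\<^sub>v p \<Longrightarrow> s = 0\<^sub>v q"
    and image: "dual_cone q K = (*\<^sub>v) (transpose_mat M) ` dual_cone p L"
  shows "(vec_topology q) interior_of (dual_cone q K) =
    (*\<^sub>v) (transpose_mat M) ` ((vec_topology p) interior_of (dual_cone p L))" (is "?A = ?I")
proof
  note Kc = closed_convex_cone_carrier[OF K] and Lc = closed_convex_cone_carrier[OF L]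
  have Mt: "transpose_mat M \<in> carrier_mat q p" using M by simp
  show "?I \<subseteq> ?A"
  proof
    fix y assume "y \<in> ?I"
    then obtain z where z: "y = transpose_mat M *\<^sub>v z" "z \<in> carrier_vec p"
        "\<And>u. u \<in> L \<Longrightarrow> u \<noteq> 0\<^sub>v p \<Longrightarrow> 0 < z \<bullet> u"
      unfolding interior_dual_cone[OF L] by blast
    have "0 < y \<bullet> s" if s: "s \<in> K" "s \<noteq> 0\<^sub>v q" for s
      using z(3)[OF into[OF s(1)]] ker[OF s(1)] s Kc
      by (auto simp: z(1) transpose_mult_scalar_prod[OF M z(2)] subset_iff)
    then show "y \<in> ?A" unfolding interior_dual_cone[OF K] using z Mt by auto
  qed
  show "?A \<subseteq> ?I"
  proof
    fix y assume y: "y \<in> ?A"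
    obtain z0 where z0: "z0 \<in> (vec_topology p) interior_of (dual_cone p L)"
      using interior_dual_cone_nonempty[OF L pointed] by blast
    then have z0c: "z0 \<in> carrier_vec p" and z0pos: "\<And>u. u \<in> L \<Longrightarrow> u \<noteq> 0\<^sub>v p \<Longrightarrow> 0 < z0 \<bullet> u"
      unfolding interior_dual_cone[OF L] by auto
    have y0: "transpose_mat M *\<^sub>v z0 \<in> carrier_vec q" using Mt z0c by auto
    obtain t where t: "t > 0" "y - t \<cdot>\<^sub>v (transpose_mat M *\<^sub>v z0) \<in> dual_cone q K"
      using interior_of_vec_topology_step[OF y y0] by blast
    then obtain z1 where z1: "z1 \<in> dual_cone p L"
        "y - t \<cdot>\<^sub>v (transpose_mat M *\<^sub>v z0) = transpose_mat M *\<^sub>v z1"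
      unfolding image by blast
    then have z1c: "z1 \<in> carrier_vec p" by (simp add: dual_cone_def)
    have yc: "y \<in> carrier_vec q" using y unfolding interior_dual_cone[OF K] by auto
    have "y = (y - t \<cdot>\<^sub>v (transpose_mat M *\<^sub>v z0)) + t \<cdot>\<^sub>v (transpose_mat M *\<^sub>v z0)"
      using yc Mt by (intro eq_vecI) auto
    also have "\<dots> = transpose_mat M *\<^sub>v (z1 + t \<cdot>\<^sub>v z0)"
      using z1c z0c by (simp add: z1(2) mult_add_distrib_mat_vec[OF Mt] mult_mat_vec[OF Mt])
    finally have "y = transpose_mat M *\<^sub>v (z1 + t \<cdot>\<^sub>v z0)" .
    moreover have "0 < (z1 + t \<cdot>\<^sub>v z0) \<bullet> u" if u: "u \<in> L" "u \<noteq> 0\<^sub>v p" for u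
    proof -
      have "(z1 + t \<cdot>\<^sub>v z0) \<bullet> u = z1 \<bullet> u + t * (z0 \<bullet> u)"
        using z1c z0c u Lc by (subst add_scalar_prod_distrib[of _ p]) auto
      moreover have "0 \<le> z1 \<bullet> u" using z1(1) u by (auto simp: dual_cone_def)
      moreover have "0 < t * (z0 \<bullet> u)" using t z0pos[OF u] by simp
      ultimately show ?thesis by simp
    qed
    ultimately show "y \<in> ?I" unfolding interior_dual_cone[OF L] using z1c z0c by auto
  qed
qed

section \<open>Block structure\<close>

text \<open>
  Testing the product against vectors with a single nonzero block isolates the condition on that block.
\<close>

lemma dual_cone_prod_PiE:
  assumes "finite J" and L: "\<And>j. j \<in> J \<Longrightarrow> L j \<subseteq> carrier_vec (p j)"
    and zero: "\<And>j. j \<in> J \<Longrightarrow> 0\<^sub>v (p j) \<in> L j"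
  shows "dual_cone_prod J p (\<Pi>\<^sub>E j\<in>J. L j) = (\<Pi>\<^sub>E j\<in>J. dual_cone (p j) (L j))" (is "?A = ?B")
proof
  show "?A \<subseteq> ?B"
  proof
    fix y assume y: "y \<in> ?A"
    then have yc: "y \<in> (\<Pi>\<^sub>E j\<in>J. carrier_vec (p j))" by (simp add: dual_cone_prod_def)
    have "0 \<le> y j \<bullet> u" if j: "j \<in> J" and u: "u \<in> L j" for j u
    proof -
      let ?z = "\<lambda>i\<in>J. if i = j then u else 0\<^sub>v (p i)"
      have "?z \<in> (\<Pi>\<^sub>E j\<in>J. L j)" using u zero by auto
      then have "0 \<le> (\<Sum>i\<in>J. y i \<bullet> ?z i)" using y unfolding dual_cone_prod_def by blast
      also have "\<dots> = (\<Sum>i\<in>J. if i = j then y j \<bullet> u else 0)"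
        using yc by (intro sum.cong) (auto simp: PiE_iff)
      also have "\<dots> = y j \<bullet> u" using j \<open>finite J\<close> by simp
      finally show ?thesis .
    qed
    then show "y \<in> ?B" using yc by (auto simp: dual_cone_def PiE_iff)
  qed
  show "?B \<subseteq> ?A"
    by (auto simp: dual_cone_prod_def dual_cone_def PiE_iff intro!: sum_nonneg)
qed

lemma block_map_image_PiE:
  "block_map J N ` (\<Pi>\<^sub>E j\<in>J. S j) = (\<Pi>\<^sub>E j\<in>J. (*\<^sub>v) (N j) ` S j)"
proof
  show "block_map J N ` (\<Pi>\<^sub>E j\<in>J. S j) \<subseteq> (\<Pi>\<^sub>E j\<in>J. (*\<^sub>v) (N j) ` S j)"
    by (auto simp: block_map_def)
  show "(\<Pi>\<^sub>E j\<in>J. (*\<^sub>v) (N j) ` S j) \<subseteq> block_map J N ` (\<Pi>\<^sub>E j\<in>J. S j)"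
  proof
    fix y assume y: "y \<in> (\<Pi>\<^sub>E j\<in>J. (*\<^sub>v) (N j) ` S j)"
    then have "\<forall>j\<in>J. \<exists>z\<in>S j. y j = N j *\<^sub>v z" by (auto simp: PiE_iff)
    then obtain z where z: "\<And>j. j \<in> J \<Longrightarrow> z j \<in> S j \<and> y j = N j *\<^sub>v z j" by metis
    have "y = block_map J N (restrict z J)"
      using y z by (intro ext) (auto simp: block_map_def PiE_iff extensional_def)
    moreover have "restrict z J \<in> (\<Pi>\<^sub>E j\<in>J. S j)" using z by auto
    ultimately show "y \<in> block_map J N ` (\<Pi>\<^sub>E j\<in>J. S j)" by blast
  qed
qed

lemma inj_on_block_mapD:
  assumes inj: "inj_on (block_map J M) (\<Pi>\<^sub>E j\<in>J. carrier_vec (q j))" and j: "j \<in> J"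
  shows "inj_on ((*\<^sub>v) (M j)) (carrier_vec (q j))"
proof (rule inj_onI)
  fix s s' assume s: "s \<in> carrier_vec (q j)" "s' \<in> carrier_vec (q j)" "M j *\<^sub>v s = M j *\<^sub>v s'"
  let ?e = "\<lambda>s. \<lambda>i\<in>J. if i = j then s else 0\<^sub>v (q i)"
  have "block_map J M (?e s) = block_map J M (?e s')"
    using s(3) by (auto simp: block_map_def fun_eq_iff)
  then have "?e s = ?e s'" by (rule inj_onD[OF inj]) (use s(1,2) in auto)
  then have "?e s j = ?e s' j" by (rule fun_cong)
  then show "s = s'" using j by simp
qed

text \<open>
  The transposed map transports dual feasibility and complementarity, the latter because
  \<open>(M\<^sup>T z) \<bullet> s = z \<bullet> (M s)\<close>; primal feasibility is the same condition in both problems.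
\<close>

lemma compl_solutions_MP_iff:
  assumes A: "\<forall>j\<in>J. A j \<in> carrier_mat (q j) n"
    and b: "\<forall>j\<in>J. b j \<in> carrier_vec (q j)"
    and M: "\<forall>j\<in>J. M j \<in> carrier_mat (p j) (q j)"
    and K: "\<forall>j\<in>J. K j \<subseteq> carrier_vec (q j)"
    and mem_iff: "\<forall>j\<in>J. \<forall>s\<in>carrier_vec (q j). s \<in> K j \<longleftrightarrow> M j *\<^sub>v s \<in> L j"
  shows "(x, z) \<in> compl_solutions (problem_MP n J p L A b c M) \<longleftrightarrow>
    z \<in> (\<Pi>\<^sub>E j\<in>J. dual_cone (p j) (L j)) \<and>
    (x, block_map J (\<lambda>j. transpose_mat (M j)) z) \<in> compl_solutions (problem_P n J q K A b c)"
proof (cases "z \<in> (\<Pi>\<^sub>E j\<in>J. dual_cone (p j) (L j)) \<and> x \<in> carrier_vec n")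
  case False
  then show ?thesis
    by (auto simp: compl_solutions_def primal_feasible_def dual_feasible_def problem_MP_def problem_P_def)
next
  case True
  let ?y = "block_map J (\<lambda>j. transpose_mat (M j)) z"
  have s: "A j *\<^sub>v x - b j \<in> carrier_vec (q j)" if "j \<in> J" for j using A b that True by auto
  have zc: "z j \<in> carrier_vec (p j)" if "j \<in> J" for j using True that by (auto simp: dual_cone_def)
  have y: "?y j = transpose_mat (M j) *\<^sub>v z j" if "j \<in> J" for j using that by (simp add: block_map_def)
  have adj: "transpose_mat (A j) *\<^sub>v (transpose_mat (M j) *\<^sub>v z j) \<in> carrier_vec n" if "j \<in> J" for j
    using A that by (intro mult_mat_vec_carrier[of _ n "q j"] mult_mat_vec_carrier[of _ "q j" "p j"])
      (use M zc that in auto)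
  then have "finsum_vec TYPE(real) n (\<lambda>j. transpose_mat (A j) *\<^sub>v ?y j) J =
      finsum_vec TYPE(real) n (\<lambda>j. transpose_mat (A j) *\<^sub>v (transpose_mat (M j) *\<^sub>v z j)) J"
    unfolding finsum_vec_def
    by (intro comm_monoid.finprod_cong'[OF comm_monoid_vec]) (auto simp: monoid_vec_simps y)
  moreover have "?y \<in> (\<Pi>\<^sub>E j\<in>J. dual_cone (q j) (K j))"
  proof (rule PiE_I)
    fix j assume j: "j \<in> J"
    have "(*\<^sub>v) (transpose_mat (M j)) ` dual_cone (p j) (L j) \<subseteq> dual_cone (q j) (K j)"
    proof (rule transpose_dual_cone_subset)
      show "M j *\<^sub>v s \<in> L j" if "s \<in> K j" for s using that K mem_iff j by blast
    qed (use M K j in auto)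
    then show "?y j \<in> dual_cone (q j) (K j)" using y[OF j] True j by auto
  qed (simp add: block_map_def)
  moreover have "?y j \<bullet> (A j *\<^sub>v x - b j) = z j \<bullet> (M j *\<^sub>v (A j *\<^sub>v x - b j))" if "j \<in> J" for j
    using M that y[OF that] transpose_mult_scalar_prod[OF _ zc[OF that] s[OF that]] by metis
  ultimately show ?thesis
    using True s mem_iff
    by (auto simp: compl_solutions_def primal_feasible_def dual_feasible_def problem_MP_def problem_P_def)
qed

theorem theorem10:
  fixes n r :: nat
    and q p :: "nat \<Rightarrow> nat"
    and K \<K> :: "nat \<Rightarrow> real vec set"
    and A M :: "nat \<Rightarrow> real mat"
    and b :: "nat \<Rightarrow> real vec"
    and c :: "real vec"
    and J :: "nat set"
    and P MP :: problem
  assumes J: "J = {1..r}"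
    and K: "\<forall>j\<in>J. regular_cone (q j) (K j)"
    and \<K>: "\<forall>j\<in>J. regular_cone (p j) (\<K> j)"
    and A: "\<forall>j\<in>J. A j \<in> carrier_mat (q j) n"
    and b: "\<forall>j\<in>J. b j \<in> carrier_vec (q j)"
    and M: "\<forall>j\<in>J. M j \<in> carrier_mat (p j) (q j)"
    and c: "c \<in> carrier_vec n"
    and P: "P = problem_P n J q K A b c"
    and MP: "MP = problem_MP n J p \<K> A b c M"
    and mem_iff: "\<forall>j\<in>J. \<forall>s\<in>carrier_vec (q j). s \<in> K j \<longleftrightarrow> M j *\<^sub>v s \<in> \<K> j"
    and strong: "strong_duality P"
    and closed_image: "closedin (product_topology (\<lambda>j. vec_topology (q j)) J)
        (block_map J (\<lambda>j. transpose_mat (M j)) ` dual_cone_prod J p (\<Pi>\<^sub>E j\<in>J. \<K> j))"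
    and one_to_one: "inj_on (block_map J M) (\<Pi>\<^sub>E j\<in>J. carrier_vec (q j))"
    and boundary_iff: "\<forall>j\<in>J. \<forall>s\<in>K j.
        M j *\<^sub>v s \<in> (vec_topology (p j)) frontier_of (\<K> j) \<longleftrightarrow>
        s \<in> (vec_topology (q j)) frontier_of (K j)"
  shows "B_set P = B_set MP \<and> N_set P = N_set MP \<and> N0_set P = N0_set MP \<and>
         B0_set MP \<subseteq> B0_set P \<and>
         ((\<forall>z\<in>dual_cone_prod J p (\<Pi>\<^sub>E j\<in>J. \<K> j).
             block_map J (\<lambda>j. transpose_mat (M j)) z = (\<lambda>j\<in>J. 0\<^sub>v (q j)) \<longrightarrow>
             z = (\<lambda>j\<in>J. 0\<^sub>v (p j))) \<longrightarrow>
          B0_set P = B0_set MP \<and> six_partition P = six_partition MP)"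
proof -
  have fin: "finite J" using J by simp
  let ?T = "block_map J (\<lambda>j. transpose_mat (M j))"
  let ?Z = "\<Pi>\<^sub>E j\<in>J. dual_cone (p j) (\<K> j)"
  have ccK: "closed_convex_cone (q j) (K j)" if "j \<in> J" for j
    using K that regular_cone_closed_convex_cone by blast
  have ccL: "closed_convex_cone (p j) (\<K> j)" if "j \<in> J" for j
    using \<K> that regular_cone_closed_convex_cone by blast
  have Kc: "K j \<subseteq> carrier_vec (q j)" if "j \<in> J" for j
    using closed_convex_cone_carrier[OF ccK[OF that]] .
  have Lc: "\<K> j \<subseteq> carrier_vec (p j)" if "j \<in> J" for j
    using closed_convex_cone_carrier[OF ccL[OF that]] .
  have Z: "dual_cone_prod J p (\<Pi>\<^sub>E j\<in>J. \<K> j) = ?Z"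
    using fin Lc ccL by (intro dual_cone_prod_PiE) (auto simp: closed_convex_cone_def)
  have zero_Z: "(\<lambda>j\<in>J. 0\<^sub>v (p j)) \<in> ?Z" using zero_in_dual_cone[OF Lc] by auto
  have TZ: "?T ` ?Z = (\<Pi>\<^sub>E j\<in>J. (*\<^sub>v) (transpose_mat (M j)) ` dual_cone (p j) (\<K> j))"
    by (rule block_map_image_PiE)
  \<comment> \<open>A nonempty product is closed only if each of its factors is, so the hypothesis on the block image
    applies to every block.\<close>
  have image: "dual_cone (q j) (K j) = (*\<^sub>v) (transpose_mat (M j)) ` dual_cone (p j) (\<K> j)"
    if j: "j \<in> J" for j
  proof (rule dual_cone_eq_transpose_image)
    have "?T ` ?Z \<noteq> {}" using zero_Z by blast
    then show "closedin (vec_topology (q j)) ((*\<^sub>v) (transpose_mat (M j)) ` dual_cone (p j) (\<K> j))"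
      using closed_image j unfolding Z TZ closedin_product_topology by blast
  qed (use M Kc[OF j] ccL[OF j] mem_iff j in auto)
  have ker: "s = 0\<^sub>v (q j)" if j: "j \<in> J" and s: "s \<in> carrier_vec (q j)" "M j *\<^sub>v s = 0\<^sub>v (p j)" for j s
  proof (rule inj_onD[OF inj_on_block_mapD[OF one_to_one j]])
    show "M j *\<^sub>v s = M j *\<^sub>v 0\<^sub>v (q j)" using M j s by (intro eq_vecI) auto
  qed (use s in auto)
  have M0: "M j *\<^sub>v 0\<^sub>v (q j) = 0\<^sub>v (p j)" "transpose_mat (M j) *\<^sub>v 0\<^sub>v (p j) = 0\<^sub>v (q j)"
    if j: "j \<in> J" for j
  proof -
    have "M j \<in> carrier_mat (p j) (q j)" using M j by blast
    then show "M j *\<^sub>v 0\<^sub>v (q j) = 0\<^sub>v (p j)" "transpose_mat (M j) *\<^sub>v 0\<^sub>v (p j) = 0\<^sub>v (q j)"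
      by (auto intro!: eq_vecI)
  qed
  have interior_image: "(vec_topology (q j)) interior_of (dual_cone (q j) (K j)) =
      (*\<^sub>v) (transpose_mat (M j)) ` ((vec_topology (p j)) interior_of (dual_cone (p j) (\<K> j)))"
    if j: "j \<in> J" for j
    using M mem_iff \<K> Kc[OF j] ker[OF j] j
    by (intro interior_dual_cone_eq_transpose_image ccK ccL image)
      (auto simp: regular_cone_def subset_iff)

  have SMP: "(x, z) \<in> compl_solutions MP \<longleftrightarrow> z \<in> ?Z \<and> (x, ?T z) \<in> compl_solutions P" for x z
    unfolding P MP using A b M Kc mem_iff by (intro compl_solutions_MP_iff) auto
  have SP_slack: "A j *\<^sub>v x - b j \<in> K j"
    if "(x, y) \<in> compl_solutions P" "j \<in> J" for x y j
    using that
    by (auto simp: P compl_solutions_def primal_feasible_def problem_P_def)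
  have lift: "\<exists>z. (x, z) \<in> compl_solutions MP \<and> y = ?T z" if "(x, y) \<in> compl_solutions P" for x y
  proof -
    have "y \<in> (\<Pi>\<^sub>E j\<in>J. dual_cone (q j) (K j))"
      using that by (auto simp: P compl_solutions_def dual_feasible_def problem_P_def)
    also have "\<dots> = ?T ` ?Z" unfolding TZ using image by (intro PiE_cong) auto
    finally show ?thesis using that SMP by auto
  qed
  have primal_parts: "(\<exists>y. (x, y) \<in> compl_solutions P) \<longleftrightarrow> (\<exists>z. (x, z) \<in> compl_solutions MP)" for x
    using lift SMP by blast

  \<comment> \<open>A point of either cone is interior iff it is not on the frontier.\<close>
  have int_iff: "M j *\<^sub>v s \<in> (vec_topology (p j)) interior_of (\<K> j) \<longleftrightarrow>
      s \<in> (vec_topology (q j)) interior_of (K j)" if j: "j \<in> J" and s: "s \<in> K j" for j s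
  proof -
    have "M j *\<^sub>v s \<in> \<K> j" using mem_iff j s Kc[OF j] by auto
    then have "M j *\<^sub>v s \<in> (vec_topology (p j)) closure_of (\<K> j)"
      using closure_of_subset[of "\<K> j" "vec_topology (p j)"] Lc[OF j] by auto
    moreover have "s \<in> (vec_topology (q j)) closure_of (K j)"
      using closure_of_subset[of "K j" "vec_topology (q j)"] Kc[OF j] s by auto
    ultimately show ?thesis using boundary_iff j s by (auto simp: frontier_of_def)
  qed
  have B: "B_set P = B_set MP"
  proof -
    have "j \<in> B_set P \<longleftrightarrow> j \<in> B_set MP" if j: "j \<in> J" for j
    proof -
      have "j \<in> B_set P \<longleftrightarrow> (\<exists>x y. (x, y) \<in> compl_solutions P \<and>
          A j *\<^sub>v x - b j \<in> (vec_topology (q j)) interior_of (K j))"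
        using j by (auto simp: B_set_def P problem_P_def)
      also have "\<dots> \<longleftrightarrow> (\<exists>x y. (x, y) \<in> compl_solutions P \<and>
          M j *\<^sub>v (A j *\<^sub>v x - b j) \<in> (vec_topology (p j)) interior_of (\<K> j))"
        using int_iff[OF j SP_slack[OF _ j]] by blast
      also have "\<dots> \<longleftrightarrow> (\<exists>x z. (x, z) \<in> compl_solutions MP \<and>
          M j *\<^sub>v (A j *\<^sub>v x - b j) \<in> (vec_topology (p j)) interior_of (\<K> j))"
        using primal_parts by blast
      also have "\<dots> \<longleftrightarrow> j \<in> B_set MP" using j by (auto simp: B_set_def MP problem_MP_def)
      finally show ?thesis .
    qed
    moreover have "B_set P \<subseteq> J" "B_set MP \<subseteq> J"
      by (auto simp: B_set_def P MP problem_P_def problem_MP_def)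
    ultimately show ?thesis by blast
  qed
  have N0: "N0_set P = N0_set MP"
  proof -
    have "j \<in> N0_set P \<longleftrightarrow> j \<in> N0_set MP" if j: "j \<in> J" for j
    proof -
      have zero_iff: "M j *\<^sub>v (A j *\<^sub>v x - b j) = 0\<^sub>v (p j) \<longleftrightarrow> A j *\<^sub>v x - b j = 0\<^sub>v (q j)" for x
        using ker[OF j, of "A j *\<^sub>v x - b j"] M0[OF j] A b j
        by (metis carrier_matD(1) carrier_vec_dim_vec dim_mult_mat_vec index_minus_vec(2) carrier_vecD)
      have "j \<in> N0_set P \<longleftrightarrow> (\<forall>x. (\<exists>y. (x, y) \<in> compl_solutions P) \<longrightarrow> A j *\<^sub>v x - b j = 0\<^sub>v (q j))"
        using j by (auto simp: N0_set_def P problem_P_def)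
      also have "\<dots> \<longleftrightarrow> (\<forall>x. (\<exists>z. (x, z) \<in> compl_solutions MP) \<longrightarrow>
          M j *\<^sub>v (A j *\<^sub>v x - b j) = 0\<^sub>v (p j))"
        unfolding zero_iff primal_parts ..
      also have "\<dots> \<longleftrightarrow> j \<in> N0_set MP" using j by (auto simp: N0_set_def MP problem_MP_def)
      finally show ?thesis .
    qed
    moreover have "N0_set P \<subseteq> J" "N0_set MP \<subseteq> J"
      by (auto simp: N0_set_def P MP problem_P_def problem_MP_def)
    ultimately show ?thesis by blast
  qed
  have T_nth: "?T z j = transpose_mat (M j) *\<^sub>v z j" if "j \<in> J" for z j
    using that by (simp add: block_map_def)
  have NP: "j \<in> N_set P \<longleftrightarrow> j \<in> J \<and> (\<exists>x y. (x, y) \<in> compl_solutions P \<and>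
      y j \<in> (vec_topology (q j)) interior_of (dual_cone (q j) (K j)))" for j
    by (auto simp: N_set_def P problem_P_def)
  have NMP: "j \<in> N_set MP \<longleftrightarrow> j \<in> J \<and> (\<exists>x z. (x, z) \<in> compl_solutions MP \<and>
      z j \<in> (vec_topology (p j)) interior_of (dual_cone (p j) (\<K> j)))" for j
    by (auto simp: N_set_def MP problem_MP_def)
  have N: "N_set P = N_set MP"
  proof
    show "N_set P \<subseteq> N_set MP"
    proof
      fix j assume "j \<in> N_set P"
      then obtain x y where j: "j \<in> J" and xy: "(x, y) \<in> compl_solutions P"
          and y: "y j \<in> (vec_topology (q j)) interior_of (dual_cone (q j) (K j))"
        unfolding NP by blast
      obtain z where z: "(x, z) \<in> compl_solutions MP" "y = ?T z" using lift[OF xy] by blast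
      \<comment> \<open>The preimage \<open>z\<close> of \<open>y\<close> need not be interior in block \<open>j\<close>; exchange that block for one that is.\<close>
      obtain w where w: "w \<in> (vec_topology (p j)) interior_of (dual_cone (p j) (\<K> j))"
          "y j = transpose_mat (M j) *\<^sub>v w"
        using y unfolding interior_image[OF j] by blast
      have "?T (z(j := w)) = y"
        unfolding z(2) using w(2) T_nth[OF j] by (auto simp: z(2) block_map_def fun_eq_iff)
      moreover have "z(j := w) \<in> ?Z"
        using z(1) SMP w(1) j interior_of_subset[of "vec_topology (p j)" "dual_cone (p j) (\<K> j)"]
        by (auto simp: PiE_iff extensional_def)
      ultimately have "(x, z(j := w)) \<in> compl_solutions MP" using SMP xy by simp
      moreover have "(z(j := w)) j \<in> (vec_topology (p j)) interior_of (dual_cone (p j) (\<K> j))"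
        using w(1) by simp
      ultimately show "j \<in> N_set MP" unfolding NMP using j by blast
    qed
    show "N_set MP \<subseteq> N_set P"
    proof
      fix j assume "j \<in> N_set MP"
      then obtain x z where j: "j \<in> J" and xz: "(x, z) \<in> compl_solutions MP"
          and z: "z j \<in> (vec_topology (p j)) interior_of (dual_cone (p j) (\<K> j))"
        unfolding NMP by blast
      have "(x, ?T z) \<in> compl_solutions P" using xz SMP by blast
      moreover have "?T z j \<in> (vec_topology (q j)) interior_of (dual_cone (q j) (K j))"
        using z unfolding interior_image[OF j] T_nth[OF j] by blast
      ultimately show "j \<in> N_set P" unfolding NP using j by blast
    qed
  qed
  have B0P: "j \<in> B0_set P \<longleftrightarrow> j \<in> J \<and> (\<forall>x y. (x, y) \<in> compl_solutions P \<longrightarrow> y j = 0\<^sub>v (q j))" for j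
    by (auto simp: B0_set_def P problem_P_def)
  have B0MP: "j \<in> B0_set MP \<longleftrightarrow> j \<in> J \<and> (\<forall>x z. (x, z) \<in> compl_solutions MP \<longrightarrow> z j = 0\<^sub>v (p j))" for j
    by (auto simp: B0_set_def MP problem_MP_def)
  have B0_sub: "B0_set MP \<subseteq> B0_set P"
  proof
    fix j assume "j \<in> B0_set MP"
    then have j: "j \<in> J" and zero: "\<And>x z. (x, z) \<in> compl_solutions MP \<Longrightarrow> z j = 0\<^sub>v (p j)"
      by (auto simp: B0MP)
    have "y j = 0\<^sub>v (q j)" if "(x, y) \<in> compl_solutions P" for x y
      using lift[OF that] zero M0(2)[OF j] T_nth[OF j] by metis
    then show "j \<in> B0_set P" using j by (auto simp: B0P)
  qed
  have "B0_set P = B0_set MP \<and> six_partition P = six_partition MP"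
    if triv: "\<forall>z\<in>dual_cone_prod J p (\<Pi>\<^sub>E j\<in>J. \<K> j). ?T z = (\<lambda>j\<in>J. 0\<^sub>v (q j)) \<longrightarrow> z = (\<lambda>j\<in>J. 0\<^sub>v (p j))"
  proof -
    have "B0_set P \<subseteq> B0_set MP"
    proof
      fix j assume "j \<in> B0_set P"
      then have j: "j \<in> J" and zero: "\<And>x y. (x, y) \<in> compl_solutions P \<Longrightarrow> y j = 0\<^sub>v (q j)"
        by (auto simp: B0P)
      have "z j = 0\<^sub>v (p j)" if xz: "(x, z) \<in> compl_solutions MP" for x z
      proof -
        \<comment> \<open>Only block \<open>j\<close> of \<open>M\<^sup>T z\<close> is known to vanish, so the other blocks are cut off before triviality
          of the kernel is applied.\<close>
        let ?z = "\<lambda>i\<in>J. if i = j then z j else 0\<^sub>v (p i)"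
        have zZ: "z \<in> ?Z" and "(x, ?T z) \<in> compl_solutions P" using xz SMP by auto
        then have "transpose_mat (M j) *\<^sub>v z j = 0\<^sub>v (q j)" using zero T_nth[OF j] by metis
        then have "?T ?z = (\<lambda>j\<in>J. 0\<^sub>v (q j))" using M0(2) by (auto simp: block_map_def fun_eq_iff)
        moreover have "?z \<in> ?Z" using zZ zero_in_dual_cone[OF Lc] j by auto
        ultimately have "?z = (\<lambda>j\<in>J. 0\<^sub>v (p j))" using triv unfolding Z by blast
        then have "?z j = (\<lambda>j\<in>J. 0\<^sub>v (p j)) j" by (rule fun_cong)
        then show ?thesis using j by simp
      qed
      then show "j \<in> B0_set MP" using j by (auto simp: B0MP)
    qed
    then have "B0_set P = B0_set MP" using B0_sub by blast
    moreover have "idx P = idx MP" by (simp add: P MP problem_P_def problem_MP_def)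
    ultimately show ?thesis using B N N0 by (simp add: six_partition_def)
  qed
  with B N N0 B0_sub show ?thesis by blast
qed

end
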